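(* Let $G$ be a bounded domain in $\mathbb{C}$. Then $\mathbf{b}(G)\le \mathbf{b}(U_1)$. If, moreover, $\partial G$ contains at least one regular point of convexity, then $\mathbf{b}(G)=\mathbf{b}(U_1)$.
   Context: A domain is a nonempty connected open set. $U_1=\{z\in\mathbb{C}:|z|<1\}$ is the unit disk and $\Pi=\{s\in\mathbb{C}:\Re s>0\}$ is the right half-plane. $H^\infty(\Pi)$ is the space of bounded holomorphic functions on $\Pi$. For a domain $G\subset\mathbb{C}$, $\widetilde G$ denotes its convex hull. A point $p\in\partial G$ is a point of convexity if $p\in\partial\widetilde G$; a point of convexity $p$ is called regular if there is an open disk $U\subset G$ with $p\in\partial U$. Isometric Bohr abscissa: for a domain $G\subset\mathbb{C}$ with $\widetilde G\ne\mathbb{C}$, $\mathbf{b}(G)$ is the infimum of those real $\sigma\ge 0$ such that for every $f\in H^\infty(\Pi)$ with $f(\Pi)\subset G$ that is represented in $\Pi$ by a convergent ordinary Dirichlet series $f(s)=\sum_{n=1}^\infty a_n n^{-s}$ one has $$\sum_{n=2}^\infty \frac{|a_n|}{n^\sigma}<\operatorname{dist}(a_1,\partial\widetilde G).$$ *)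

theory Defs
  imports "HOL-Complex_Analysis.Complex_Analysis"
begin

definition is_domain :: "complex set \<Rightarrow> bool" where
  "is_domain G \<longleftrightarrow> G \<noteq> {} \<and> open G \<and> connected G"

definition unit_disk :: "complex set" where
  "unit_disk = {z. norm z < 1}"

definition right_halfplane :: "complex set" where
  "right_halfplane = {s. Re s > 0}"

definition H_infinity :: "(complex \<Rightarrow> complex) set" where
  "H_infinity = {f. f holomorphic_on right_halfplane \<and> bounded (f ` right_halfplane)}"

text \<open>Coefficients are indexed from 1; the value \<open>a 0\<close> is never used. Convergence is that of the
  ordered partial sums, which may be conditional.\<close>

definition represented_by_Dirichlet :: "(complex \<Rightarrow> complex) \<Rightarrow> (nat \<Rightarrow> complex) \<Rightarrow> bool" where
  "represented_by_Dirichlet f a \<longleftrightarrow>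
     (\<forall>s\<in>right_halfplane. (\<lambda>n. a (Suc n) * of_nat (Suc n) powr (- s)) sums f s)"

definition point_of_convexity :: "complex set \<Rightarrow> complex \<Rightarrow> bool" where
  "point_of_convexity G p \<longleftrightarrow> p \<in> frontier G \<and> p \<in> frontier (convex hull G)"

definition regular_point_of_convexity :: "complex set \<Rightarrow> complex \<Rightarrow> bool" where
  "regular_point_of_convexity G p \<longleftrightarrow>
     point_of_convexity G p \<and> (\<exists>c r. r > 0 \<and> ball c r \<subseteq> G \<and> p \<in> frontier (ball c r))"

text \<open>The sum over \<open>n \<ge> 2\<close> has nonnegative terms, so the strict inequality includes its convergence;
  this must be required separately because \<open>suminf\<close> is a total function.\<close>

definition Bohr_inequality :: "complex set \<Rightarrow> (nat \<Rightarrow> complex) \<Rightarrow> real \<Rightarrow> bool" where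
  "Bohr_inequality G a \<sigma> \<longleftrightarrow>
     summable (\<lambda>n. norm (a (n + 2)) / real (n + 2) powr \<sigma>) \<and>
     (\<Sum>n. norm (a (n + 2)) / real (n + 2) powr \<sigma>) < infdist (a 1) (frontier (convex hull G))"

text \<open>The infimum is taken in the extended reals, so that it would be \<open>\<infinity>\<close> if no \<open>\<sigma>\<close> were
  admissible. The definition is meaningful only if \<open>convex hull G \<noteq> UNIV\<close>, because \<open>infdist\<close> to the
  empty set is 0.\<close>

definition Bohr_abscissa :: "complex set \<Rightarrow> ereal" where
  "Bohr_abscissa G = Inf (ereal ` {\<sigma>. \<sigma> \<ge> 0 \<and>
     (\<forall>f\<in>H_infinity. \<forall>a. f ` right_halfplane \<subseteq> G \<longrightarrow> represented_by_Dirichlet f a \<longrightarrow>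
        Bohr_inequality G a \<sigma>)})"

end

theory Submission imports Defs begin

text \<open>
  Both inequalities come from postcomposing with affine maps \<open>w \<mapsto> k w + b\<close>: these act on a Dirichlet
  series by scaling every coefficient by \<open>k\<close> and shifting only the constant one, so the left-hand
  side of the Bohr inequality is scaled by \<open>\<bar>k\<bar>\<close> and only the position of \<open>a\<^sub>1\<close> needs care.

  For \<open>b(G) \<le> b(U\<^sub>1)\<close>, let \<open>f\<close> map into \<open>G\<close> and let \<open>p\<close> be a boundary point of the convex hull
  nearest to \<open>a\<^sub>1\<close>. A supporting line at \<open>p\<close> puts \<open>f\<close> into a half-plane. Since \<open>f\<close> is bounded, it also
  maps into a disk that is only slightly deeper: for every \<open>d' > \<bar>p - a\<^sub>1\<bar>\<close>, the values of \<open>f\<close> lie in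
  a huge disk that has \<open>a\<^sub>1\<close> at distance \<open>d'\<close> from its boundary. An exponent \<open>\<sigma>\<close> that is admissible
  for the unit disk then bounds the Bohr sum by \<open>d'\<close>, hence by \<open>\<bar>p - a\<^sub>1\<bar>\<close>
  (\<open>Bohr_sum_le_dist_outside_hull\<close>). The limit \<open>d' \<rightarrow> \<bar>p - a\<^sub>1\<bar>\<close> loses strictness, but any larger
  exponent restores it, because the Bohr sum of a nonconstant series is strictly decreasing in the
  exponent. The infimum does not notice this enlargement.

  For the converse at a regular point of convexity \<open>p\<close>, place a copy of the unit disk onto the
  disk in \<open>G\<close> that touches \<open>p\<close>, rotated so that the image of \<open>a\<^sub>1\<close> lies on the ray from the centre to
  \<open>p\<close>. The distance from that image to the boundary of the hull is at most its distance to \<open>p\<close>,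
  which is the rescaled distance from \<open>a\<^sub>1\<close> to the unit circle.
\<close>

section \<open>Affine images of Dirichlet series\<close>

definition Bohr_admissible :: "complex set \<Rightarrow> real \<Rightarrow> bool" where
  "Bohr_admissible G \<sigma> \<longleftrightarrow> \<sigma> \<ge> 0 \<and>
     (\<forall>f\<in>H_infinity. \<forall>a. f ` right_halfplane \<subseteq> G \<longrightarrow> represented_by_Dirichlet f a \<longrightarrow>
        Bohr_inequality G a \<sigma>)"

lemma Bohr_abscissa_eq_Inf: "Bohr_abscissa G = Inf (ereal ` {\<sigma>. Bohr_admissible G \<sigma>})"
  by (simp add: Bohr_abscissa_def Bohr_admissible_def)

lemma Bohr_admissibleD:
  assumes "Bohr_admissible G \<sigma>" "f \<in> H_infinity" "f ` right_halfplane \<subseteq> G"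
    "represented_by_Dirichlet f a"
  shows "Bohr_inequality G a \<sigma>"
  using assms by (auto simp: Bohr_admissible_def)

lemma H_infinity_affine:
  assumes "f \<in> H_infinity"
  shows "(\<lambda>s. k * f s + b) \<in> H_infinity"
proof -
  have hol: "f holomorphic_on right_halfplane" and bdd: "bounded (f ` right_halfplane)"
    using assms by (auto simp: H_infinity_def)
  obtain M where M: "\<And>s. s \<in> right_halfplane \<Longrightarrow> norm (f s) \<le> M"
    using bdd by (auto simp: bounded_iff)
  have "norm (k * f s + b) \<le> norm k * M + norm b" if "s \<in> right_halfplane" for s
    using norm_triangle_ineq[of "k * f s" b] mult_left_mono[OF M[OF that], of "norm k"]
    by (simp add: norm_mult)
  then have "bounded ((\<lambda>s. k * f s + b) ` right_halfplane)"
    by (auto simp: bounded_iff)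
  moreover have "(\<lambda>s. k * f s + b) holomorphic_on right_halfplane"
    by (intro holomorphic_intros hol)
  ultimately show ?thesis
    by (simp add: H_infinity_def)
qed

lemma represented_by_Dirichlet_affine:
  assumes "represented_by_Dirichlet f a"
  shows "represented_by_Dirichlet (\<lambda>s. k * f s + b) (\<lambda>n. k * a n + (if n = 1 then b else 0))"
  unfolding represented_by_Dirichlet_def
proof
  fix s assume s: "s \<in> right_halfplane"
  have "(\<lambda>n. k * (a (Suc n) * of_nat (Suc n) powr (- s))) sums (k * f s)"
    using assms s by (intro sums_mult) (auto simp: represented_by_Dirichlet_def)
  moreover have "(\<lambda>n. if n = 0 then b else 0) sums b"
    using sums_If_finite_set[of "{0::nat}" "\<lambda>_. b"] by simp
  ultimately have "(\<lambda>n. k * (a (Suc n) * of_nat (Suc n) powr (- s)) + (if n = 0 then b else 0))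
      sums (k * f s + b)"
    by (rule sums_add)
  moreover have "k * (a (Suc n) * of_nat (Suc n) powr (- s)) + (if n = 0 then b else 0) =
      (k * a (Suc n) + (if Suc n = 1 then b else 0)) * of_nat (Suc n) powr (- s)" for n
    by (cases n) (auto simp: algebra_simps)
  ultimately show "(\<lambda>n. (k * a (Suc n) + (if Suc n = 1 then b else 0)) *
      of_nat (Suc n) powr (- s)) sums (k * f s + b)"
    by simp
qed

lemma represented_by_Dirichlet_constant:
  assumes "represented_by_Dirichlet f a" "\<And>n. a (n + 2) = 0" "s \<in> right_halfplane"
  shows "f s = a 1"
proof -
  have "(\<lambda>n. a (Suc n) * of_nat (Suc n) powr (- s)) sums f s"
    using assms by (auto simp: represented_by_Dirichlet_def)
  moreover have "a (Suc n) * of_nat (Suc n) powr (- s) = (if n = 0 then a 1 else 0)" for n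
    using assms(2)[of "n - 1"] by (cases n) auto
  ultimately have "(\<lambda>n. if n = 0 then a 1 else 0) sums f s"
    by simp
  moreover have "(\<lambda>n. if n = 0 then a 1 else 0) sums a 1"
    using sums_If_finite_set[of "{0::nat}" "\<lambda>_. a 1"] by simp
  ultimately show ?thesis
    by (rule sums_unique2)
qed

text \<open>Admissibility for \<open>G\<close> thus says something about every bounded series, wherever its values lie,
  through each affine map that carries them into \<open>G\<close>; both comparisons rest on this.\<close>

lemma Bohr_admissible_affine:
  assumes "Bohr_admissible G \<sigma>" "f \<in> H_infinity" "represented_by_Dirichlet f a"
    and into: "\<And>s. s \<in> right_halfplane \<Longrightarrow> k * f s + b \<in> G" and "k \<noteq> 0"
  shows "summable (\<lambda>n. norm (a (n + 2)) / real (n + 2) powr \<sigma>)"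
    and "norm k * (\<Sum>n. norm (a (n + 2)) / real (n + 2) powr \<sigma>)
           < infdist (k * a 1 + b) (frontier (convex hull G))"
proof -
  have "Bohr_inequality G (\<lambda>n. k * a n + (if n = 1 then b else 0)) \<sigma>"
    using into by (intro Bohr_admissibleD[OF assms(1) H_infinity_affine[OF assms(2)] _
          represented_by_Dirichlet_affine[OF assms(3)]]) auto
  then have sm: "summable (\<lambda>n. norm k * (norm (a (n + 2)) / real (n + 2) powr \<sigma>))"
    and lt: "(\<Sum>n. norm k * (norm (a (n + 2)) / real (n + 2) powr \<sigma>))
           < infdist (k * a 1 + b) (frontier (convex hull G))"
    by (simp_all add: Bohr_inequality_def norm_mult)
  show *: "summable (\<lambda>n. norm (a (n + 2)) / real (n + 2) powr \<sigma>)"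
    using sm \<open>k \<noteq> 0\<close> by (subst (asm) summable_cmult_iff) simp
  show "norm k * (\<Sum>n. norm (a (n + 2)) / real (n + 2) powr \<sigma>)
           < infdist (k * a 1 + b) (frontier (convex hull G))"
    using lt suminf_mult[OF *, of "norm k"] by simp
qed

section \<open>From the disk to half-planes and convex hulls\<close>

lemma frontier_convex_hull_unit_disk: "frontier (convex hull unit_disk) = sphere 0 1"
proof -
  have ball: "unit_disk = ball 0 1"
    by (auto simp: unit_disk_def)
  show ?thesis
    unfolding ball hull_same[where S = convex, OF convex_ball] by (simp add: frontier_ball)
qed

text \<open>The disk \<open>\<bar>w + R - d'\<bar> < R\<close> is the disk of radius \<open>R\<close> inside \<open>Re w < d'\<close> that touches the
  bounding line at \<open>d'\<close>. As \<open>R \<rightarrow> \<infinity>\<close> these disks exhaust the half-plane, so one of them contains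
  the bounded part of the smaller half-plane \<open>Re w \<le> d\<close>.\<close>

lemma bounded_halfplane_subset_disk:
  fixes d d' M :: real
  assumes "0 \<le> d" "d < d'"
  obtains R where "R > d'"
    "\<And>w. Re w \<le> d \<Longrightarrow> norm w \<le> M \<Longrightarrow> norm (w + of_real (R - d')) < R"
proof
  define R where "R = (M\<^sup>2 + d'\<^sup>2) / (2 * (d' - d)) + d' + 1"
  have pos: "d' - d > 0"
    using assms by simp
  then show R: "R > d'"
    by (simp add: R_def add_nonneg_pos)
  have "2 * R * (d' - d) = M\<^sup>2 + d'\<^sup>2 + 2 * (d' + 1) * (d' - d)"
    using pos by (simp add: R_def field_simps)
  moreover have "2 * (d' + 1) * (d' - d) > 0"
    using assms by simp
  ultimately have key: "M\<^sup>2 + d'\<^sup>2 < 2 * R * (d' - d)"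
    by linarith
  fix w :: complex assume w: "Re w \<le> d" "norm w \<le> M"
  have "(norm (w + of_real (R - d')))\<^sup>2 = (norm w)\<^sup>2 + 2 * (R - d') * Re w + (R - d')\<^sup>2"
    unfolding cmod_power2 by (simp add: power2_eq_square algebra_simps)
  also have "\<dots> \<le> M\<^sup>2 + 2 * (R - d') * d + (R - d')\<^sup>2"
    using w R by (intro add_mono mult_left_mono power_mono) auto
  also have "\<dots> = R\<^sup>2 + (M\<^sup>2 + d'\<^sup>2 - 2 * R * (d' - d)) - 2 * d * d'"
    by (simp add: power2_eq_square algebra_simps)
  also have "\<dots> < R\<^sup>2"
  proof -
    have "0 \<le> d * d'"
      using assms by simp
    then show ?thesis
      using key by linarith
  qed
  finally show "norm (w + of_real (R - d')) < R"
    by (rule power_less_imp_less_base) (use R assms in linarith)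
qed

text \<open>The half-plane inherits the Bohr inequality of the disk because every \<open>d' > d\<close> is the distance
  from \<open>a\<^sub>1\<close> to the boundary of some disk containing the values of \<open>f\<close>. Letting \<open>d'\<close> decrease to \<open>d\<close>
  leaves only the weak inequality.\<close>

lemma Bohr_sum_le_halfplane:
  assumes adm: "Bohr_admissible unit_disk \<sigma>"
    and f: "f \<in> H_infinity" "represented_by_Dirichlet f a"
    and v: "norm v = 1" and "0 \<le> d"
    and half: "\<And>s. s \<in> right_halfplane \<Longrightarrow> Re (v * (f s - a 1)) \<le> d"
  shows "summable (\<lambda>n. norm (a (n + 2)) / real (n + 2) powr \<sigma>)"
    and "(\<Sum>n. norm (a (n + 2)) / real (n + 2) powr \<sigma>) \<le> d"
proof -
  obtain M where M: "\<And>s. s \<in> right_halfplane \<Longrightarrow> norm (v * (f s - a 1)) \<le> M"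
    using H_infinity_affine[OF f(1), of v "- v * a 1"]
    by (auto simp: H_infinity_def bounded_iff algebra_simps)
  have *: "summable (\<lambda>n. norm (a (n + 2)) / real (n + 2) powr \<sigma>) \<and>
      (\<Sum>n. norm (a (n + 2)) / real (n + 2) powr \<sigma>) \<le> d'" if d': "d < d'" for d'
  proof -
    obtain R where R: "R > d'"
      and disk: "\<And>w. Re w \<le> d \<Longrightarrow> norm w \<le> M \<Longrightarrow> norm (w + of_real (R - d')) < R"
      using bounded_halfplane_subset_disk[OF \<open>0 \<le> d\<close> d'] by blast
    have "R > 0"
      using R d' \<open>0 \<le> d\<close> by linarith
    \<comment> \<open>The affine map that takes the disk of radius \<open>R\<close> to the unit disk and \<open>a\<^sub>1\<close> to \<open>(R - d')/R\<close>,
      at distance \<open>d'/R\<close> from the unit circle.\<close>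
    define k where "k = v / of_real R"
    define b where "b = (of_real (R - d') - v * a 1) / of_real R"
    have affine: "k * z + b = (v * (z - a 1) + of_real (R - d')) / of_real R" for z
      by (simp add: k_def b_def algebra_simps add_divide_distrib diff_divide_distrib)
    have into: "k * f s + b \<in> unit_disk" if s: "s \<in> right_halfplane" for s
      unfolding affine unit_disk_def
      using disk[OF half[OF s] M[OF s]] \<open>R > 0\<close> by (simp add: norm_divide)
    have "k \<noteq> 0"
      using v \<open>R > 0\<close> by (auto simp: k_def)
    note bohr = Bohr_admissible_affine[OF adm f into \<open>k \<noteq> 0\<close>]
    have "infdist (k * a 1 + b) (sphere 0 1) \<le> dist (k * a 1 + b) 1"
      by (rule infdist_le) simp
    also have "\<dots> = norm (of_real (- d' / R) :: complex)"
      unfolding affine dist_norm using \<open>R > 0\<close>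
      by (intro arg_cong[where f = norm]) (simp add: field_simps)
    also have "\<dots> = d' / R"
      unfolding norm_of_real using \<open>R > 0\<close> d' \<open>0 \<le> d\<close> by simp
    finally have "norm k * (\<Sum>n. norm (a (n + 2)) / real (n + 2) powr \<sigma>) < d' / R"
      using bohr(2) by (simp add: frontier_convex_hull_unit_disk)
    then have "(\<Sum>n. norm (a (n + 2)) / real (n + 2) powr \<sigma>) < d'"
      using v \<open>R > 0\<close> by (simp add: k_def norm_divide divide_simps)
    then show ?thesis
      using bohr(1) by simp
  qed
  show "summable (\<lambda>n. norm (a (n + 2)) / real (n + 2) powr \<sigma>)"
    using *[OF less_add_one] by (rule conjunct1)
  show "(\<Sum>n. norm (a (n + 2)) / real (n + 2) powr \<sigma>) \<le> d"
    by (rule dense_ge) (rule conjunct2[OF *])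
qed

text \<open>The values of \<open>f\<close> stay on one side of a line through \<open>p\<close>, and that line is at distance at
  most \<open>\<bar>p - a\<^sub>1\<bar>\<close> from \<open>a\<^sub>1\<close>. This includes an \<open>a\<^sub>1\<close> outside the hull: \<open>p = a\<^sub>1\<close> then forces the
  series to be constant.\<close>

lemma Bohr_sum_le_dist_outside_hull:
  assumes adm: "Bohr_admissible unit_disk \<sigma>"
    and f: "f \<in> H_infinity" "represented_by_Dirichlet f a" "f ` right_halfplane \<subseteq> G"
    and p: "p \<notin> convex hull G"
  shows "summable (\<lambda>n. norm (a (n + 2)) / real (n + 2) powr \<sigma>)"
    and "(\<Sum>n. norm (a (n + 2)) / real (n + 2) powr \<sigma>) \<le> dist (a 1) p"
proof -
  have "(1 :: complex) \<in> right_halfplane"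
    by (simp add: right_halfplane_def)
  then have "convex hull G \<noteq> {}"
    using f(3) by auto
  then obtain n \<beta> where n: "n \<noteq> 0" "\<And>x. x \<in> convex hull G \<Longrightarrow> n \<bullet> x \<le> \<beta>" "\<beta> \<le> n \<bullet> p"
    using separating_hyperplane_sets[of "convex hull G" "{p}"] p by auto
  define v where "v = cnj (sgn n)"
  have v: "norm v = 1"
    using n(1) by (simp add: v_def norm_sgn)
  have "Re (v * (f s - a 1)) \<le> dist (a 1) p" if s: "s \<in> right_halfplane" for s
  proof -
    have "f s \<in> convex hull G"
      using s f(3) hull_subset[of G convex] by blast
    then have "n \<bullet> (f s - p) \<le> 0"
      using n(2)[of "f s"] n(3) by (simp add: inner_diff_right)
    moreover have "Re (v * w) = (n \<bullet> w) / norm n" for w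
      by (simp add: v_def sgn_div_norm inner_complex_def add_divide_distrib divide_inverse algebra_simps)
    ultimately have "Re (v * (f s - p)) \<le> 0"
      by (simp only: divide_nonpos_nonneg norm_ge_zero)
    moreover have "Re (v * (p - a 1)) \<le> dist (a 1) p"
      using complex_Re_le_cmod[of "v * (p - a 1)"] v
      by (simp only: norm_mult dist_norm norm_minus_commute mult_1)
    moreover have "v * (f s - a 1) = v * (f s - p) + v * (p - a 1)"
      by (simp add: algebra_simps)
    ultimately show ?thesis
      by (simp only: plus_complex.sel)
  qed
  then show "summable (\<lambda>n. norm (a (n + 2)) / real (n + 2) powr \<sigma>)"
    and "(\<Sum>n. norm (a (n + 2)) / real (n + 2) powr \<sigma>) \<le> dist (a 1) p"
    using Bohr_sum_le_halfplane[OF adm f(1,2) v zero_le_dist] by blast+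
qed

section \<open>Admissible exponents of the disk and of a bounded domain\<close>

lemma Bohr_sum_strict_antimono:
  fixes a :: "nat \<Rightarrow> complex"
  assumes sm: "summable (\<lambda>n. norm (a (n + 2)) / real (n + 2) powr \<sigma>)" and "\<sigma> < \<sigma>'"
  shows "summable (\<lambda>n. norm (a (n + 2)) / real (n + 2) powr \<sigma>')"
    and "a (m + 2) \<noteq> 0 \<Longrightarrow> (\<Sum>n. norm (a (n + 2)) / real (n + 2) powr \<sigma>')
           < (\<Sum>n. norm (a (n + 2)) / real (n + 2) powr \<sigma>)"
proof -
  have less: "real (n + 2) powr \<sigma> < real (n + 2) powr \<sigma>'" for n
    using \<open>\<sigma> < \<sigma>'\<close> by (intro powr_less_mono) auto
  have le: "norm (a (n + 2)) / real (n + 2) powr \<sigma>' \<le> norm (a (n + 2)) / real (n + 2) powr \<sigma>" for n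
    using less[of n] by (intro divide_left_mono mult_pos_pos) auto
  show sm': "summable (\<lambda>n. norm (a (n + 2)) / real (n + 2) powr \<sigma>')"
    by (rule summable_comparison_test'[OF sm, where N = 0]) (use le in simp)
  assume m: "a (m + 2) \<noteq> 0"
  have "norm (a (m + 2)) / real (m + 2) powr \<sigma>' < norm (a (m + 2)) / real (m + 2) powr \<sigma>"
    using less[of m] m by (intro divide_strict_left_mono mult_pos_pos) auto
  then have "0 < (\<Sum>n. norm (a (n + 2)) / real (n + 2) powr \<sigma> -
      norm (a (n + 2)) / real (n + 2) powr \<sigma>')"
    using le by (intro suminf_pos2[OF summable_diff[OF sm sm'], of m]) auto
  then show "(\<Sum>n. norm (a (n + 2)) / real (n + 2) powr \<sigma>')
           < (\<Sum>n. norm (a (n + 2)) / real (n + 2) powr \<sigma>)"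
    using suminf_diff[OF sm sm'] by simp
qed

text \<open>Passing to \<open>\<sigma>'\<close> buys back strictness for a nonconstant series; for a constant one the Bohr sum
  is zero and the distance is positive.\<close>

lemma Bohr_admissible_unit_disk_imp:
  assumes G: "open G" "bounded G" and adm: "Bohr_admissible unit_disk \<sigma>" and "\<sigma> < \<sigma>'"
  shows "Bohr_admissible G \<sigma>'"
  unfolding Bohr_admissible_def
proof (intro conjI ballI allI impI)
  show "0 \<le> \<sigma>'"
    using adm \<open>\<sigma> < \<sigma>'\<close> by (simp add: Bohr_admissible_def)
  fix f a
  assume f: "f \<in> H_infinity" "f ` right_halfplane \<subseteq> G" "represented_by_Dirichlet f a"
  have s1: "(1 :: complex) \<in> right_halfplane"
    by (simp add: right_halfplane_def)
  have opn: "open (convex hull G)"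
    by (rule open_convex_hull[OF G(1)])
  have hull: "convex hull G \<noteq> {}" "convex hull G \<noteq> UNIV"
    using f(2) s1 bounded_convex_hull[OF G(2)] not_bounded_UNIV by auto
  then have ne: "frontier (convex hull G) \<noteq> {}"
    by (simp add: frontier_eq_empty)
  have disj: "frontier (convex hull G) \<inter> convex hull G = {}"
    using opn by (auto simp: frontier_def interior_open)
  obtain p where p: "p \<in> frontier (convex hull G)"
    "infdist (a 1) (frontier (convex hull G)) = dist (a 1) p"
    using infdist_attains_inf[OF frontier_closed ne] by metis
  have "p \<notin> convex hull G"
    using p(1) disj by auto
  note bound = Bohr_sum_le_dist_outside_hull[OF adm f(1,3,2) this]
  note sm' = Bohr_sum_strict_antimono(1)[OF bound(1) \<open>\<sigma> < \<sigma>'\<close>]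
  have "(\<Sum>n. norm (a (n + 2)) / real (n + 2) powr \<sigma>')
      < infdist (a 1) (frontier (convex hull G))"
  proof (cases "\<exists>m. a (m + 2) \<noteq> 0")
    case True
    then show ?thesis
      using Bohr_sum_strict_antimono(2)[OF bound(1) \<open>\<sigma> < \<sigma>'\<close>] bound(2) p(2) by fastforce
  next
    \<comment> \<open>A constant series: \<open>a\<^sub>1\<close> is a value of \<open>f\<close>, hence an interior point of the hull.\<close>
    case False
    then have "a 1 = f 1"
      using represented_by_Dirichlet_constant[OF f(3) _ s1] by simp
    then have "a 1 \<in> convex hull G"
      using f(2) s1 hull_subset[of G convex] by auto
    then have "a 1 \<noteq> p"
      using p(1) disj by auto
    then show ?thesis
      using False p(2) by simp
  qed
  then show "Bohr_inequality G a \<sigma>'"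
    using sm' by (simp add: Bohr_inequality_def)
qed

text \<open>Along the radius of the touching disk towards \<open>p\<close>, the distance to the boundary of the hull is
  at most the distance to the circle, so the inequality for \<open>G\<close> gives that for the disk with the same exponent.\<close>

lemma Bohr_admissible_imp_unit_disk:
  assumes reg: "regular_point_of_convexity G p" and adm: "Bohr_admissible G \<sigma>"
  shows "Bohr_admissible unit_disk \<sigma>"
  unfolding Bohr_admissible_def
proof (intro conjI ballI allI impI)
  show "0 \<le> \<sigma>"
    using adm by (simp add: Bohr_admissible_def)
  obtain c r where r: "r > 0" and ball: "ball c r \<subseteq> G" and pr: "norm (p - c) = r"
    and pfr: "p \<in> frontier (convex hull G)"
    using reg
    by (auto simp: regular_point_of_convexity_def point_of_convexity_def dist_norm norm_minus_commute)
  fix f a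
  assume f: "f \<in> H_infinity" "f ` right_halfplane \<subseteq> unit_disk" "represented_by_Dirichlet f a"
  \<comment> \<open>The factor \<open>k\<close> has modulus \<open>r\<close> and turns \<open>a\<^sub>1\<close> into the direction of \<open>p - c\<close>; if \<open>a\<^sub>1 = 0\<close>, any
    rotation will do.\<close>
  define k where "k = (if a 1 = 0 then 1 else cnj (sgn (a 1))) * (p - c)"
  have norm_k: "norm k = r"
    using pr by (simp add: k_def norm_mult norm_sgn)
  have "cnj (sgn (a 1)) * a 1 = of_real (norm (a 1))" if "a 1 \<noteq> 0"
    using that complex_norm_square[of "a 1"]
    by (simp add: sgn_div_norm scaleR_conv_of_real field_simps power2_eq_square)
  then have ka: "k * a 1 = of_real (norm (a 1)) * (p - c)"
    by (auto simp: k_def mult_ac)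
  have into: "k * f s + c \<in> G" if "s \<in> right_halfplane" for s
  proof -
    have "norm (f s) < 1"
      using f(2) that by (auto simp: unit_disk_def)
    then have "k * f s + c \<in> ball c r"
      using r norm_k by (simp add: dist_norm norm_mult)
    then show ?thesis
      using ball by blast
  qed
  have "k \<noteq> 0"
    using norm_k r by auto
  note bohr = Bohr_admissible_affine[OF adm f(1,3) into \<open>k \<noteq> 0\<close>]
  have "infdist (k * a 1 + c) (frontier (convex hull G)) \<le> dist (k * a 1 + c) p"
    by (rule infdist_le[OF pfr])
  also have "\<dots> = norm (of_real (norm (a 1) - 1) * (p - c))"
    unfolding dist_norm ka by (intro arg_cong[where f = norm]) (simp add: algebra_simps)
  also have "\<dots> = r * \<bar>norm (a 1) - 1\<bar>"
    unfolding norm_mult norm_of_real pr by simp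
  also have "\<dots> \<le> r * infdist (a 1) (sphere 0 1)"
  proof -
    have ne: "sphere (0 :: complex) 1 \<noteq> {}"
      by simp
    obtain q where "q \<in> sphere 0 1" "infdist (a 1) (sphere 0 1) = dist (a 1) q"
      using infdist_attains_inf[OF closed_sphere ne] by metis
    then have "\<bar>norm (a 1) - 1\<bar> \<le> infdist (a 1) (sphere 0 1)"
      using norm_triangle_ineq3[of "a 1" q] by (simp add: dist_norm)
    then show ?thesis
      using r by simp
  qed
  finally have "norm k * (\<Sum>n. norm (a (n + 2)) / real (n + 2) powr \<sigma>)
      < r * infdist (a 1) (sphere 0 1)"
    using bohr(2) by simp
  then show "Bohr_inequality unit_disk a \<sigma>"
    using bohr(1) r norm_k by (simp add: Bohr_inequality_def frontier_convex_hull_unit_disk)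
qed

theorem theorem2p1:
  fixes G :: "complex set"
  assumes "is_domain G" and "bounded G"
  shows "Bohr_abscissa G \<le> Bohr_abscissa unit_disk \<and>
    ((\<exists>p\<in>frontier G. regular_point_of_convexity G p) \<longrightarrow>
       Bohr_abscissa G = Bohr_abscissa unit_disk)"
proof -
  have "open G"
    using assms(1) by (simp add: is_domain_def)
  have le: "Bohr_abscissa G \<le> Bohr_abscissa unit_disk"
    unfolding Bohr_abscissa_eq_Inf[of unit_disk]
  proof (rule INF_greatest)
    fix \<sigma> assume "\<sigma> \<in> {\<sigma>. Bohr_admissible unit_disk \<sigma>}"
    then have "Bohr_admissible G (\<sigma> + e)" if "e > 0" for e
      using Bohr_admissible_unit_disk_imp[OF \<open>open G\<close> assms(2), of \<sigma> "\<sigma> + e"] that by simp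
    then have "Bohr_abscissa G \<le> ereal \<sigma> + ereal e" if "e > 0" for e
      unfolding Bohr_abscissa_eq_Inf plus_ereal.simps(1) using that by (intro INF_lower) blast
    then show "Bohr_abscissa G \<le> ereal \<sigma>"
      by (rule ereal_le_epsilon2)
  qed
  moreover have "Bohr_abscissa unit_disk \<le> Bohr_abscissa G"
    if "regular_point_of_convexity G p" for p
    unfolding Bohr_abscissa_eq_Inf
    by (rule INF_superset_mono) (use Bohr_admissible_imp_unit_disk[OF that] in blast, rule order_refl)
  ultimately show ?thesis
    by (blast intro: antisym)
qed

end
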